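(* Let $N\ge2$, $R>0$, $p>1$. Assume $f\in C^1([0,R])$ and $$-\frac{p-1}{(pr)^{\frac{p}{p-1}}}<f(r)\quad\text{for } r\in(0,R).$$ Consider the equation $$(\ast)\qquad -\lambda_i(D^2u)+|Du|^p=f(|x|)\quad\text{in }B_R.$$ Then: (a) if $1<i<N$, there exists a radial solution $u\in C^2(\overline{B_R})$ of $(\ast)$; (b) if $i=1$ and we further assume that $f(r)\le0$ and $f'(r)\le0$ in $[0,R]$, then there exists a radially nondecreasing solution $u\in C^2(\overline{B_R})$ of $(\ast)$; (c) if $i=1$ and we further assume that $f$ is a nonnegative constant function, then there exists a radially nonincreasing solution $u\in C^2(\overline{B_R})$ of $(\ast)$.
   Context: $B_R\subset\mathbb{R}^N$ is the open ball of radius $R$ centered at $0$. For a real symmetric $N\times N$ matrix $X$, $\lambda_1(X)\le\dots\le\lambda_N(X)$ denote its eigenvalues in nondecreasing order. A function $u$ is radial if $u(x)=U(|x|)$ for some function $U$; it is radially nondecreasing (respectively nonincreasing) if moreover $U$ is nondecreasing (respectively nonincreasing). Since the solutions are $C^2$, the equation is satisfied in the classical (pointwise) sense.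
   Formalization: In (a) and (b), u in C^2 of the closed ball is claimed only if the strict inequality for f also holds at r=R (the literal claim fails for constant f equal to the critical value at R); otherwise u is C^2 in the open ball and C^1 up to the boundary. *)

theory Defs
  imports "HOL-Analysis.Analysis" "HOL-Computational_Algebra.Polynomial"
begin

definition charpoly :: "real ^ 'n ^ 'n \<Rightarrow> real poly" where
  "charpoly X = det (mat [:0, 1:] - (\<chi> k l. [: X $ k $ l :]))"

text \<open>
  The \<open>i\<close>-th smallest eigenvalue, counted with multiplicity and indexed from \<open>1\<close>. For symmetric
  \<open>X\<close> all the roots of the characteristic polynomial are real, so the list has length \<open>CARD('n)\<close>
  and the value is meaningful for \<open>1 \<le> i \<le> CARD('n)\<close>.
\<close>

definition eigval :: "nat \<Rightarrow> real ^ 'n ^ 'n \<Rightarrow> real" where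
  "eigval i X = sorted_list_of_multiset (proots (charpoly X)) ! (i - 1)"

definition grad :: "(real ^ 'n \<Rightarrow> real) \<Rightarrow> real ^ 'n \<Rightarrow> real ^ 'n" where
  "grad u x = (\<chi> k. frechet_derivative u (at x) (axis k 1))"

definition hessian :: "(real ^ 'n \<Rightarrow> real) \<Rightarrow> real ^ 'n \<Rightarrow> real ^ 'n ^ 'n" where
  "hessian u x = jacobian (grad u) (at x)"

definition C2_on :: "(real ^ 'n) set \<Rightarrow> (real ^ 'n \<Rightarrow> real) \<Rightarrow> bool" where
  "C2_on S u \<longleftrightarrow>
     (\<forall>x\<in>S. u differentiable (at x) \<and> grad u differentiable (at x)) \<and>
     continuous_on S (hessian u)"

text \<open>
  For open \<open>S\<close>, the spaces \<open>C\<^sup>1\<close> and \<open>C\<^sup>2\<close> of the closure of \<open>S\<close>: the derivatives exist in \<open>S\<close>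
  and extend continuously to the closure.
\<close>

definition C1_closure :: "(real ^ 'n) set \<Rightarrow> (real ^ 'n \<Rightarrow> real) \<Rightarrow> bool" where
  "C1_closure S u \<longleftrightarrow>
     continuous_on (closure S) u \<and> (\<forall>x\<in>S. u differentiable (at x)) \<and>
     (\<exists>G. continuous_on (closure S) G \<and> (\<forall>x\<in>S. G x = grad u x))"

definition C2_closure :: "(real ^ 'n) set \<Rightarrow> (real ^ 'n \<Rightarrow> real) \<Rightarrow> bool" where
  "C2_closure S u \<longleftrightarrow>
     C1_closure S u \<and> (\<forall>x\<in>S. grad u differentiable (at x)) \<and>
     (\<exists>H. continuous_on (closure S) H \<and> (\<forall>x\<in>S. H x = hessian u x))"

definition radial_on :: "(real ^ 'n) set \<Rightarrow> (real ^ 'n \<Rightarrow> real) \<Rightarrow> bool" where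
  "radial_on S u \<longleftrightarrow> (\<exists>U. \<forall>x\<in>S. u x = U (norm x))"

definition radially_nondecreasing_on :: "(real ^ 'n) set \<Rightarrow> (real ^ 'n \<Rightarrow> real) \<Rightarrow> bool" where
  "radially_nondecreasing_on S u \<longleftrightarrow>
     (\<exists>U. mono_on (norm ` S) U \<and> (\<forall>x\<in>S. u x = U (norm x)))"

definition radially_nonincreasing_on :: "(real ^ 'n) set \<Rightarrow> (real ^ 'n \<Rightarrow> real) \<Rightarrow> bool" where
  "radially_nonincreasing_on S u \<longleftrightarrow>
     (\<exists>U. antimono_on (norm ` S) U \<and> (\<forall>x\<in>S. u x = U (norm x)))"

definition solves :: "nat \<Rightarrow> real \<Rightarrow> (real \<Rightarrow> real) \<Rightarrow> real \<Rightarrow> (real ^ 'n \<Rightarrow> real) \<Rightarrow> bool" where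
  "solves i p f R u \<longleftrightarrow>
     (\<forall>x\<in>ball 0 R. - eigval i (hessian u x) + norm (grad u x) powr p = f (norm x))"

definition critical :: "real \<Rightarrow> real \<Rightarrow> real" where
  "critical p r = - ((p - 1) / (p * r) powr (p / (p - 1)))"

text \<open>
  \<open>critical p r\<close> is the minimum of \<open>\<bar>v\<bar> powr p - v / r\<close> over \<open>v\<close>. If \<open>critical p r < f r\<close> for all
  \<open>r < R\<close> but \<open>f R = critical p R\<close>, the second derivative of radial solutions may blow up at the
  boundary (it does for constant \<open>f\<close>), so regularity \<open>C\<^sup>2\<close> up to the boundary requires
  \<open>critical p R < f R\<close> as well; without it, what remains is \<open>C\<^sup>2\<close> inside and \<open>C\<^sup>1\<close> up to the
  boundary.
\<close>

end

theory Submission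
  imports Defs
begin

text \<open>
  Let \<open>u x = U (norm x)\<close> and write \<open>U' r = r * W r\<close>. The Hessian of \<open>u\<close> at \<open>x\<close>, with \<open>r = norm x\<close>,
  is \<open>W r\<close> times the identity plus a multiple of \<open>x x\<^sup>T\<close>; its eigenvalues are \<open>W r\<close> (at least
  \<open>N - 1\<close> times) and \<open>U'' r = W r + r * W' r\<close>. Hence the \<open>i\<close>-th eigenvalue is \<open>W r\<close> whenever
  \<open>1 < i < N\<close>, and also for \<open>i = 1\<close> as long as \<open>W' \<ge> 0\<close> (\<open>eigval_scalar_plus_rank_one\<close>). In all
  these cases the partial differential equation collapses to an equation without derivatives,
  \<open>r\<^sup>p \<bar>W r\<bar>\<^sup>p - W r = f r\<close>.

  For fixed \<open>r > 0\<close> the left-hand side is a strictly convex function of \<open>W r\<close> with minimum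
  \<open>critical p r\<close>. The hypothesis on \<open>f\<close> says that \<open>f r\<close> lies above this minimum, so the equation
  has exactly one root on the decreasing side of the minimum. This is the branch that stays
  bounded as \<open>r\<close> tends to 0, where it becomes \<open>W 0 = - f 0\<close>. It is continuous on \<open>[0, R]\<close>
  because its graph is closed and bounded (\<open>branch_cont\<close>), and differentiable where the root is
  not the minimum point (\<open>branch_has_derivative\<close>), with
  \<open>W' r = (p r\<^sup>p\<^sup>-\<^sup>1 \<bar>W r\<bar>\<^sup>p - f' r) / (1 - r\<^sup>p h' (W r))\<close> for \<open>h w = \<bar>w\<bar>\<^sup>p\<close>. The denominator is positive,
  so \<open>f' \<le> 0\<close> implies \<open>W' \<ge> 0\<close>, which admits \<open>i = 1\<close>. Finally \<open>W\<close> has the sign opposite to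
  that of \<open>f\<close>, so \<open>u\<close> is nondecreasing for \<open>f \<le> 0\<close> and nonincreasing for \<open>f \<ge> 0\<close>. One and the
  same function thus serves all three parts.
\<close>

section \<open>Eigenvalues of a scalar matrix plus a rank-one matrix\<close>

lemma poly_det:
  fixes A :: "real poly ^ 'n ^ 'n"
  shows "poly (det A) t = det (\<chi> i j. poly (A $ i $ j) t)"
  by (simp add: det_def poly_sum poly_prod)

text \<open>
  An orthogonal change of basis that sends a coordinate axis to the line through \<open>x\<close> diagonalises
  the matrix, with \<open>s - c * (norm x)\<^sup>2\<close> on that axis and \<open>s\<close> on all others.
\<close>

lemma det_scalar_minus_rank_one:
  fixes x :: "real ^ 'n"
  shows "det (mat s - (\<chi> k l. c * x $ k * x $ l)) = s ^ (CARD('n) - 1) * (s - c * (norm x)\<^sup>2)"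
proof -
  obtain k :: 'n where True by simp
  obtain g :: "real ^ 'n \<Rightarrow> real ^ 'n"
    where g: "orthogonal_transformation g" "g (norm x *\<^sub>R axis k 1) = x"
  proof (rule orthogonal_transformation_exists)
    show "norm (norm x *\<^sub>R axis k (1 :: real)) = norm x" by simp
  qed
  define Q where "Q = matrix g"
  have oQ: "orthogonal_matrix Q" and lin: "linear g"
    using g(1) by (auto simp: Q_def orthogonal_transformation_matrix)
  have x: "x $ i = norm x * Q $ i $ k" for i
  proof -
    have "g (norm x *\<^sub>R axis k 1) $ i = norm x * g (axis k 1) $ i"
      by (simp add: linear_scale[OF lin])
    then show ?thesis unfolding g(2) by (simp add: Q_def matrix_def)
  qed
  define d where "d l = (if l = k then s - c * (norm x)\<^sup>2 else s)" for l
  define D :: "real^'n^'n" where "D = (\<chi> i j. if i = j then d i else 0)"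
  have QQ: "(\<Sum>l\<in>UNIV. Q $ i $ l * Q $ j $ l) = (if i = j then 1 else 0)" for i j
  proof -
    have "Q ** transpose Q = mat 1" using oQ by (simp add: orthogonal_matrix_def)
    then have "(Q ** transpose Q) $ i $ j = mat 1 $ i $ j" by simp
    then show ?thesis by (simp add: matrix_matrix_mult_def transpose_def mat_def)
  qed
  have "mat s - (\<chi> k l. c * x $ k * x $ l) = Q ** D ** transpose Q"
  proof (simp add: vec_eq_iff, intro allI)
    fix i j
    have "(Q ** D ** transpose Q) $ i $ j = (\<Sum>l\<in>UNIV. Q $ i $ l * d l * Q $ j $ l)"
      by (simp add: matrix_matrix_mult_def transpose_def D_def if_distrib cong: if_cong)
    also have "\<dots> = (\<Sum>l\<in>UNIV. s * (Q $ i $ l * Q $ j $ l)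
        - (if l = k then c * (norm x)\<^sup>2 * Q $ i $ k * Q $ j $ k else 0))"
      by (intro sum.cong) (auto simp: d_def algebra_simps)
    also have "\<dots> = s * (if i = j then 1 else 0) - c * (norm x)\<^sup>2 * Q $ i $ k * Q $ j $ k"
      by (simp add: sum_subtractf sum_distrib_left[symmetric] QQ)
    also have "\<dots> = mat s $ i $ j - c * x $ i * x $ j"
      unfolding x[of i] x[of j] by (simp add: mat_def power2_eq_square)
    finally show "mat s $ i $ j - c * x $ i * x $ j = (Q ** D ** transpose Q) $ i $ j" by simp
  qed
  then have "det (mat s - (\<chi> k l. c * x $ k * x $ l)) = det D * (det Q * det Q)"
    by (simp only: det_mul det_transpose mult_ac)
  also have "det Q * det Q = 1"
    using det_orthogonal_matrix[OF oQ] by auto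
  also have "det D = (\<Prod>l\<in>UNIV. d l)"
    by (subst det_diagonal) (auto simp: D_def)
  also have "\<dots> = d k * (\<Prod>l\<in>UNIV - {k}. d l)"
    by (simp add: prod.remove)
  also have "(\<Prod>l\<in>UNIV - {k}. d l) = s ^ (CARD('n) - 1)"
    by (simp add: d_def card_Diff_singleton)
  finally show ?thesis by (simp add: d_def mult.commute)
qed

text \<open>
  Both sides are compared at every real \<open>t\<close>, which moves the determinant from the ring of
  polynomials to the reals, where the matrix can be diagonalised orthogonally.
\<close>

lemma charpoly_scalar_plus_rank_one:
  fixes x :: "real ^ 'n"
  shows "charpoly (mat a + (\<chi> k l. b * x $ k * x $ l))
    = [:- a, 1:] ^ (CARD('n) - 1) * [:- (a + b * (norm x)\<^sup>2), 1:]"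
proof (rule poly_ext)
  fix t :: real
  have "(\<chi> i j. poly ((mat [:0, 1:] - (\<chi> k l. [:(mat a + (\<chi> k l. b * x $ k * x $ l)) $ k $ l:])) $ i $ j) t)
      = mat (t - a) - (\<chi> k l. b * x $ k * x $ l)"
    by (auto simp: vec_eq_iff mat_def)
  then have "poly (charpoly (mat a + (\<chi> k l. b * x $ k * x $ l))) t
      = det (mat (t - a) - (\<chi> k l. b * x $ k * x $ l))"
    unfolding charpoly_def poly_det by (rule arg_cong)
  moreover have "poly [:- c, 1:] t = t - c" for c
    by simp
  ultimately show "poly (charpoly (mat a + (\<chi> k l. b * x $ k * x $ l))) t
      = poly ([:- a, 1:] ^ (CARD('n) - 1) * [:- (a + b * (norm x)\<^sup>2), 1:]) t"
    by (simp only: det_scalar_minus_rank_one poly_mult poly_power diff_diff_eq)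
qed

text \<open>
  Sorting the \<open>N - 1\<close> copies of \<open>a\<close> and the one value \<open>a + b * (norm x)\<^sup>2\<close> puts the latter first or
  last. Positions strictly between are always occupied by \<open>a\<close>; position 1 is so when \<open>0 \<le> b\<close>.
\<close>

lemma eigval_scalar_plus_rank_one:
  fixes x :: "real ^ 'n"
  assumes "1 \<le> i" "i < CARD('n)" "1 < i \<or> 0 \<le> b"
  shows "eigval i (mat a + (\<chi> k l. b * x $ k * x $ l)) = a"
proof -
  define m where "m = a + b * (norm x)\<^sup>2"
  define n where "n = CARD('n) - 1"
  have "proots (charpoly (mat a + (\<chi> k l. b * x $ k * x $ l))) = replicate_mset n a + {#m#}"
    unfolding charpoly_scalar_plus_rank_one m_def[symmetric] n_def[symmetric]
    by (subst proots_mult) (auto simp: proots_power)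
  then have e: "proots (charpoly (mat a + (\<chi> k l. b * x $ k * x $ l))) = mset (m # replicate n a)"
    by simp
  have "sorted_list_of_multiset (replicate_mset n a) = replicate n a"
    by (induction n) (simp_all add: insort_is_Cons)
  then have sort: "sorted_list_of_multiset (mset (m # replicate n a)) = insort m (replicate n a)"
    by simp
  have ins: "insort m (replicate n a) = (if m \<le> a then m # replicate n a else replicate n a @ [m])"
    by (induction n) simp_all
  have "insort m (replicate n a) ! (i - 1) = a"
  proof (cases "i = 1")
    case True
    then have "a \<le> m" "0 < n" using assms by (simp_all add: m_def n_def)
    then show ?thesis using True unfolding ins by (simp add: nth_append)
  next
    case False
    then have "0 < i - 1" "i - 1 < n" using assms by (simp_all add: n_def)
    then show ?thesis unfolding ins by (simp add: nth_append nth_Cons_pos)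
  qed
  then show ?thesis
    unfolding eigval_def e sort by simp
qed

section \<open>Radial functions with prescribed ratio of slope to radius\<close>

text \<open>
  The radial function \<open>u\<close> with \<open>grad u x = W (norm x) *\<^sub>R x\<close>. Working with \<open>W r = U' r / r\<close> instead of
  \<open>U'\<close> removes the apparent singularity of the Hessian at the origin. At the end point \<open>R\<close> only
  continuity of \<open>W\<close> is required, since \<open>W'\<close> may blow up there.
\<close>

locale radial_gradient =
  fixes R :: real and W W' :: "real \<Rightarrow> real"
  assumes R_pos: "0 < R"
    and W_cont: "continuous_on {0..R} W"
    and W_deriv: "\<And>r. 0 < r \<Longrightarrow> r < R \<Longrightarrow> (W has_real_derivative W' r) (at r)"
    and W'_cont: "continuous_on {0..<R} W'"
begin

definition potential :: "real ^ 'n \<Rightarrow> real" where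
  "potential x = integral {0..norm x} (\<lambda>t. t * W t)"

text \<open>
  At \<open>x = 0\<close> the convention \<open>W' 0 / 0 = 0\<close> makes the second summand vanish, so the formula gives the
  correct value \<open>mat (W 0)\<close> there.
\<close>

definition potential_hessian :: "real ^ 'n \<Rightarrow> real ^ 'n ^ 'n" where
  "potential_hessian x = mat (W (norm x)) + (\<chi> k l. W' (norm x) / norm x * x $ k * x $ l)"

lemma profile_deriv:
  assumes "r \<in> {0..R}"
  shows "((\<lambda>r. integral {0..r} (\<lambda>t. t * W t)) has_real_derivative r * W r) (at r within {0..R})"
  by (rule integral_has_real_derivative[OF _ assms]) (intro continuous_intros W_cont)

text \<open>
  The norm is differentiable away from the origin only, so \<open>x = 0\<close> is treated on its own: there the
  profile has slope 0, and the difference quotient along \<open>norm y\<close> tends to 0.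
\<close>

lemma potential_has_derivative:
  fixes x :: "real ^ 'n"
  assumes "x \<in> ball 0 R"
  shows "(potential has_derivative (\<lambda>h. (W (norm x) *\<^sub>R x) \<bullet> h)) (at x)"
proof (cases "x = 0")
  case True
  define U where "U r = integral {0..r} (\<lambda>t. t * W t)" for r
  have "((\<lambda>t. (U t - U 0) / (t - 0)) \<longlongrightarrow> 0) (at 0 within {0..R})"
    using profile_deriv[of 0] R_pos by (simp add: U_def has_field_derivative_iff)
  moreover have "filterlim (norm :: real ^ 'n \<Rightarrow> real) (at 0 within {0..R}) (at 0)"
    unfolding filterlim_at eventually_conj_iff
  proof (intro conjI)
    show "\<forall>\<^sub>F y :: real ^ 'n in at 0. norm y \<in> {0..R}"
      unfolding eventually_at using R_pos by (intro exI[of _ R]) (auto simp: dist_norm)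
    show "\<forall>\<^sub>F y :: real ^ 'n in at 0. norm y \<noteq> 0"
      unfolding eventually_at by (intro exI[of _ 1]) auto
    show "(norm \<longlongrightarrow> 0) (at (0 :: real ^ 'n))"
      using tendsto_norm[OF tendsto_ident_at, of "0 :: real ^ 'n" UNIV] by simp
  qed
  ultimately have "((\<lambda>y :: real ^ 'n. (U (norm y) - U 0) / (norm y - 0)) \<longlongrightarrow> 0) (at 0)"
    by (rule filterlim_compose)
  then have "((\<lambda>y :: real ^ 'n. U (norm y) / norm y) \<longlongrightarrow> 0) (at 0)"
    by (simp add: U_def)
  then show ?thesis
    unfolding True has_derivative_def
    by (simp add: potential_def U_def divide_inverse mult.commute bounded_linear_inner_right)
next
  case False
  then have r: "norm x \<in> {0<..<R}" using assms by simp
  then have "((\<lambda>r. integral {0..r} (\<lambda>t. t * W t)) has_real_derivative norm x * W (norm x)) (at (norm x))"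
    using profile_deriv[of "norm x"] by (simp add: at_within_Icc_at)
  from DERIV_compose_FDERIV[OF this has_derivative_norm[OF False]]
  show ?thesis
    unfolding potential_def using False by (simp add: sgn_div_norm inner_commute field_simps)
qed

lemma grad_potential:
  fixes x :: "real ^ 'n"
  assumes "x \<in> ball 0 R"
  shows "grad potential x = W (norm x) *\<^sub>R x"
  unfolding grad_def frechet_derivative_at[OF potential_has_derivative[OF assms], symmetric]
  by (simp add: vec_eq_iff inner_axis)

text \<open>
  At the origin the derivative is \<open>W 0\<close> times the identity by continuity of \<open>W\<close> alone; elsewhere the
  product and chain rules apply. The convention \<open>sgn 0 = 0\<close> covers both cases by one formula.
\<close>

lemma radial_field_has_derivative:
  fixes x :: "real ^ 'n"
  assumes "x \<in> ball 0 R"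
  shows "((\<lambda>x. W (norm x) *\<^sub>R x) has_derivative (*v) (potential_hessian x)) (at x)"
proof -
  have eq: "(*v) (potential_hessian x) = (\<lambda>h. W (norm x) *\<^sub>R h + (W' (norm x) * (sgn x \<bullet> h)) *\<^sub>R x)"
  proof
    fix h
    have "(\<Sum>j\<in>UNIV. W' (norm x) / norm x * x $ i * x $ j * h $ j) = (W' (norm x) * (sgn x \<bullet> h)) * x $ i" for i
      by (simp add: sgn_div_norm inner_vec_def sum_distrib_left sum_distrib_right field_simps)
    moreover have "(\<Sum>j\<in>UNIV. mat (W (norm x)) $ i $ j * h $ j) = W (norm x) * h $ i" for i
      by (simp add: mat_def if_distrib[of "\<lambda>c. c * _"] cong: if_cong)
    ultimately show "potential_hessian x *v h = W (norm x) *\<^sub>R h + (W' (norm x) * (sgn x \<bullet> h)) *\<^sub>R x"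
      by (simp add: vec_eq_iff matrix_vector_mult_def potential_hessian_def distrib_right sum.distrib)
  qed
  show ?thesis
  proof (cases "x = 0")
    case True
    have "continuous_on (ball 0 R) (\<lambda>y :: real ^ 'n. W (norm y))"
      by (rule continuous_on_compose2[OF W_cont]) (auto intro: continuous_intros)
    then have "((\<lambda>y :: real ^ 'n. W (norm y)) \<longlongrightarrow> W 0) (at 0)"
      using R_pos by (auto simp: continuous_on_eq_continuous_at isCont_def dest: bspec[of _ _ 0])
    then have "((\<lambda>y :: real ^ 'n. W (norm y) - W 0) \<longlongrightarrow> 0) (at 0)"
      by (subst (asm) Lim_null)
    then have 1: "((\<lambda>y :: real ^ 'n. \<bar>W (norm y) - W 0\<bar>) \<longlongrightarrow> 0) (at 0)"
      by (simp add: tendsto_rabs_zero_iff)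
    have "((\<lambda>y :: real ^ 'n. norm ((W (norm y) *\<^sub>R y - W 0 *\<^sub>R y) /\<^sub>R norm y)) \<longlongrightarrow> 0) (at 0)"
      by (rule Lim_transform_eventually[OF 1])
        (auto simp: eventually_at scaleR_diff_left[symmetric] abs_mult intro!: exI[of _ 1])
    from tendsto_norm_zero_cancel[OF this] show ?thesis
      unfolding eq unfolding True has_derivative_def
      by (simp add: bounded_linear_scaleR_right)
  next
    case False
    then have "(W has_real_derivative W' (norm x)) (at (norm x))"
      using assms by (intro W_deriv) auto
    from has_derivative_scaleR[OF DERIV_compose_FDERIV[OF this has_derivative_norm[OF False]] has_derivative_ident]
    show ?thesis unfolding eq by (simp add: inner_commute mult.commute)
  qed
qed

lemma grad_potential_has_derivative:
  fixes x :: "real ^ 'n"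
  assumes "x \<in> ball 0 R"
  shows "(grad potential has_derivative (*v) (potential_hessian x)) (at x)"
  by (rule has_derivative_transform_within_open[OF radial_field_has_derivative[OF assms] open_ball assms])
    (simp add: grad_potential)

lemma hessian_potential:
  fixes x :: "real ^ 'n"
  assumes "x \<in> ball 0 R"
  shows "hessian potential x = potential_hessian x"
  unfolding hessian_def jacobian_def
    frechet_derivative_at[OF grad_potential_has_derivative[OF assms], symmetric]
  by (rule matrix_of_matrix_vector_mul)

text \<open>
  Only the factor \<open>x\<^sub>k x\<^sub>l / norm x\<close> is delicate; its absolute value is at most
  \<open>norm x\<close>, hence it is continuous at 0.
\<close>

lemma continuous_on_potential_hessian:
  fixes S :: "(real ^ 'n) set"
  assumes "continuous_on (norm ` S) W" "continuous_on (norm ` S) W'"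
  shows "continuous_on S potential_hessian"
proof -
  have quot: "continuous_on UNIV (\<lambda>x :: real ^ 'n. x $ k / norm x * x $ l)" for k l
    unfolding continuous_on_eq_continuous_at[OF open_UNIV]
  proof
    fix x :: "real ^ 'n"
    show "isCont (\<lambda>x. x $ k / norm x * x $ l) x"
    proof (cases "x = 0")
      case True
      have l: "((\<lambda>y :: real ^ 'n. norm y) \<longlongrightarrow> 0) (at 0)"
        using tendsto_norm[OF tendsto_ident_at, of "0 :: real ^ 'n" UNIV] by simp
      have "norm (y $ k / norm y * y $ l) \<le> norm y" for y :: "real ^ 'n"
      proof -
        have "\<bar>y $ k / norm y\<bar> \<le> 1"
          by (cases "y = 0") (auto simp: component_le_norm_cart)
        then have "\<bar>y $ k / norm y\<bar> * \<bar>y $ l\<bar> \<le> 1 * norm y"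
          by (intro mult_mono component_le_norm_cart) auto
        then show ?thesis by (simp add: abs_mult)
      qed
      then have "((\<lambda>y :: real ^ 'n. y $ k / norm y * y $ l) \<longlongrightarrow> 0) (at 0)"
        by (intro Lim_null_comparison[OF _ l]) auto
      then show ?thesis unfolding isCont_def True by simp
    qed (auto intro!: continuous_intros)
  qed
  have W'S: "continuous_on S (\<lambda>x. W' (norm x))" and WS: "continuous_on S (\<lambda>x. W (norm x))"
    by (rule continuous_on_compose2[OF assms(2)] continuous_on_compose2[OF assms(1)],
        auto intro: continuous_intros)+
  have "continuous_on S (\<lambda>x. mat (W (norm x)) $ k $ l + W' (norm x) * (x $ k / norm x * x $ l))" for k l
  proof (rule continuous_on_add[OF _ continuous_on_mult[OF W'S continuous_on_subset[OF quot]]])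
    show "continuous_on S (\<lambda>x. mat (W (norm x)) $ k $ l)"
      by (cases "k = l") (simp_all add: mat_def WS)
  qed simp
  then have "continuous_on S (\<lambda>x. potential_hessian x $ k $ l)" for k l
    by (simp add: potential_hessian_def mult.assoc)
  then have "continuous_on S (\<lambda>x. \<chi> k. \<chi> l. potential_hessian x $ k $ l)"
    by (intro continuous_on_vec_lambda)
  then show ?thesis by simp
qed

lemma C2_on_potential: "C2_on (ball 0 R) (potential :: real ^ 'n \<Rightarrow> real)"
proof -
  have "continuous_on (ball 0 R) (potential_hessian :: real ^ 'n \<Rightarrow> _)"
    by (rule continuous_on_potential_hessian)
      (auto intro!: continuous_on_subset[OF W_cont] continuous_on_subset[OF W'_cont])
  then have "continuous_on (ball 0 R) (hessian (potential :: real ^ 'n \<Rightarrow> real))"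
    by (rule continuous_on_eq) (simp add: hessian_potential)
  then show ?thesis
    unfolding C2_on_def differentiable_def
    using potential_has_derivative grad_potential_has_derivative by blast
qed

lemma C1_closure_potential: "C1_closure (ball 0 R) (potential :: real ^ 'n \<Rightarrow> real)"
proof -
  have cl: "closure (ball 0 R) = (cball 0 R :: (real ^ 'n) set)"
    using R_pos by (intro closure_ball) simp
  have "continuous_on {0..R} (\<lambda>r. integral {0..r} (\<lambda>t. t * W t))"
    by (rule DERIV_continuous_on[OF profile_deriv])
  then have "continuous_on (cball 0 R) (potential :: real ^ 'n \<Rightarrow> real)"
    unfolding potential_def by (rule continuous_on_compose2) (auto intro: continuous_intros)
  moreover have "continuous_on (cball 0 R) (\<lambda>x :: real ^ 'n. W (norm x) *\<^sub>R x)"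
    by (intro continuous_intros continuous_on_compose2[OF W_cont]) auto
  ultimately show ?thesis
    unfolding C1_closure_def cl differentiable_def
    using potential_has_derivative
    by (intro conjI ballI exI[of _ "\<lambda>x. W (norm x) *\<^sub>R x"]) (auto simp: grad_potential)
qed

lemma C2_closure_potential:
  assumes "continuous_on {0..R} W'"
  shows "C2_closure (ball 0 R) (potential :: real ^ 'n \<Rightarrow> real)"
proof -
  have cl: "closure (ball 0 R) = (cball 0 R :: (real ^ 'n) set)"
    using R_pos by (intro closure_ball) simp
  have "continuous_on (cball 0 R) (potential_hessian :: real ^ 'n \<Rightarrow> _)"
    by (rule continuous_on_potential_hessian)
      (auto intro!: continuous_on_subset[OF W_cont] continuous_on_subset[OF assms])
  then show ?thesis
    unfolding C2_closure_def cl differentiable_def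
    using C1_closure_potential grad_potential_has_derivative
    by (intro conjI ballI exI[of _ potential_hessian]) (auto simp: hessian_potential)
qed

lemma radial_on_potential: "radial_on S potential"
  unfolding radial_on_def potential_def by (intro exI[of _ "\<lambda>r. integral {0..r} (\<lambda>t. t * W t)"]) simp

lemma radially_nondecreasing_potential:
  assumes "\<And>r. r \<in> {0..R} \<Longrightarrow> 0 \<le> W r"
  shows "radially_nondecreasing_on (cball 0 R) (potential :: real ^ 'n \<Rightarrow> real)"
  unfolding radially_nondecreasing_on_def
proof (intro exI conjI)
  show "mono_on (norm ` cball (0 :: real ^ 'n) R) (\<lambda>r. integral {0..r} (\<lambda>t. t * W t))"
  proof (rule mono_onI)
    fix r s assume "r \<in> norm ` cball (0::real^'n) R" "s \<in> norm ` cball (0::real^'n) R" "r \<le> s"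
    then show "integral {0..r} (\<lambda>t. t * W t) \<le> integral {0..s} (\<lambda>t. t * W t)"
      using assms
      by (intro integral_subset_le integrable_continuous_real continuous_on_mult continuous_on_minus
          continuous_on_id continuous_on_subset[OF W_cont]) (auto intro: mult_nonneg_nonpos)
  qed
qed (simp add: potential_def)

lemma radially_nonincreasing_potential:
  assumes "\<And>r. r \<in> {0..R} \<Longrightarrow> W r \<le> 0"
  shows "radially_nonincreasing_on (cball 0 R) (potential :: real ^ 'n \<Rightarrow> real)"
  unfolding radially_nonincreasing_on_def
proof (intro exI conjI)
  show "antimono_on (norm ` cball (0 :: real ^ 'n) R) (\<lambda>r. integral {0..r} (\<lambda>t. t * W t))"
  proof (rule monotone_onI)
    fix r s assume "r \<in> norm ` cball (0::real^'n) R" "s \<in> norm ` cball (0::real^'n) R" "r \<le> s"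
    then have "integral {0..r} (\<lambda>t. t * - W t) \<le> integral {0..s} (\<lambda>t. t * - W t)"
      using assms
      by (intro integral_subset_le integrable_continuous_real continuous_on_mult continuous_on_minus
          continuous_on_id continuous_on_subset[OF W_cont]) (auto intro: mult_nonneg_nonpos)
    then show "integral {0..s} (\<lambda>t. t * W t) \<le> integral {0..r} (\<lambda>t. t * W t)"
      by simp
  qed
qed (simp add: potential_def)

text \<open>
  The two kinds of eigenvalue of the Hessian are \<open>W r\<close> and \<open>W r + r * W' r\<close>. For \<open>i = 1\<close> the former
  has to be the smaller one, which is a condition on \<open>W'\<close> away from the origin; at the origin the two
  coincide.
\<close>

lemma solves_potential:
  assumes "\<And>r. r \<in> {0..<R} \<Longrightarrow> - W r + \<bar>r * W r\<bar> powr p = f r"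
    and "1 \<le> i" "i < CARD('n)" "1 < i \<or> (\<forall>r\<in>{0<..<R}. 0 \<le> W' r)"
  shows "solves i p f R (potential :: real ^ 'n \<Rightarrow> real)"
  unfolding solves_def
proof
  fix x :: "real ^ 'n" assume x: "x \<in> ball 0 R"
  have "eigval i (hessian potential x) = W (norm x)"
    unfolding hessian_potential[OF x] potential_hessian_def
  proof (rule eigval_scalar_plus_rank_one)
    show "1 < i \<or> 0 \<le> W' (norm x) / norm x"
      using assms(4) x by (cases "x = 0") auto
  qed (use assms in auto)
  then show "- eigval i (hessian potential x) + norm (grad potential x) powr p = f (norm x)"
    using assms(1)[of "norm x"] x by (simp add: grad_potential[OF x] abs_mult mult.commute)
qed

end

section \<open>Powers of the absolute value\<close>

text \<open>
  The derivative of \<open>\<lambda>w. \<bar>w\<bar> powr p\<close>. Its strict monotonicity expresses the strict convexity of that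
  function.
\<close>

definition abs_powr_deriv :: "real \<Rightarrow> real \<Rightarrow> real" where
  "abs_powr_deriv p w = p * sgn w * \<bar>w\<bar> powr (p - 1)"

lemma abs_powr_has_derivative:
  assumes "1 < p"
  shows "((\<lambda>w :: real. \<bar>w\<bar> powr p) has_real_derivative abs_powr_deriv p w) (at w)"
proof (cases "w = 0")
  case True
  have lim: "((\<lambda>h :: real. \<bar>h\<bar> powr (p - 1)) \<longlongrightarrow> 0) (at 0)"
    using assms by (intro tendsto_zero_powrI[of _ _ _ "p - 1"]) (auto intro!: tendsto_eq_intros)
  have "\<bar>h\<bar> powr (p - 1) = norm (\<bar>h\<bar> powr p / h)" if "h \<noteq> 0" for h :: real
    using that by (simp add: powr_diff abs_divide)
  then have "((\<lambda>h :: real. norm (\<bar>h\<bar> powr p / h)) \<longlongrightarrow> 0) (at 0)"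
    by (intro Lim_transform_eventually[OF lim]) (auto simp: eventually_at intro!: exI[of _ 1])
  then have "((\<lambda>h :: real. \<bar>h\<bar> powr p / h) \<longlongrightarrow> 0) (at 0)"
    by (rule tendsto_norm_zero_cancel)
  then show ?thesis
    using assms by (simp add: True abs_powr_deriv_def has_field_derivative_iff)
next
  case False
  then have "(abs has_real_derivative sgn w) (at w)"
    using has_derivative_norm[OF False] by (simp add: has_field_derivative_def mult_commute_abs real_norm_def[abs_def])
  then have "((\<lambda>w. \<bar>w\<bar> powr p) has_real_derivative p * \<bar>w\<bar> powr (p - 1) * sgn w) (at w)"
    using False by (intro DERIV_chain2[OF has_real_derivative_powr]) auto
  then show ?thesis by (simp add: abs_powr_deriv_def mult_ac)
qed

lemma continuous_abs_powr_deriv: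
  assumes "1 < p" 
  shows "isCont (abs_powr_deriv p) w"
proof (cases "w = 0")
  case True
  have "((\<lambda>h :: real. norm (abs_powr_deriv p h)) \<longlongrightarrow> 0) (at 0)"
  proof (rule Lim_transform_eventually)
    show "((\<lambda>h :: real. p * \<bar>h\<bar> powr (p - 1)) \<longlongrightarrow> 0) (at 0)"
      using assms by (intro tendsto_mult_right_zero tendsto_zero_powrI[of _ _ _ "p - 1"]) (auto intro!: tendsto_eq_intros)
    show "\<forall>\<^sub>F h :: real in at 0. p * \<bar>h\<bar> powr (p - 1) = norm (abs_powr_deriv p h)"
      using assms by (auto simp: eventually_at abs_powr_deriv_def abs_mult abs_sgn_eq intro!: exI[of _ 1])
  qed
  then show ?thesis
    using assms by (simp add: True isCont_def abs_powr_deriv_def[of p 0] tendsto_rabs_zero_iff)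
next
  case False
  then show ?thesis
    unfolding abs_powr_deriv_def[abs_def] by (intro continuous_intros) auto
qed

text \<open>
  On either side of 0 this is monotonicity of \<open>powr\<close> with the positive exponent \<open>p - 1\<close>; across 0
  the sign decides.
\<close>

lemma abs_powr_deriv_less_iff:
  assumes "1 < p"
  shows "abs_powr_deriv p v < abs_powr_deriv p w \<longleftrightarrow> v < w"
proof -
  have less: "abs_powr_deriv p v < abs_powr_deriv p w" if "v < w" for v w :: real
  proof -
    consider "0 \<le> v" | "v < 0" "0 < w" | "w \<le> 0" by linarith
    then show ?thesis
    proof cases
      case 1
      then show ?thesis using that assms
        by (cases "v = 0") (auto simp: abs_powr_deriv_def intro!: powr_less_mono2)
    next
      case 2
      then have "abs_powr_deriv p v < 0" "0 < abs_powr_deriv p w"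
        using assms by (auto simp: abs_powr_deriv_def)
      then show ?thesis by linarith
    next
      case 3
      then show ?thesis using that assms
        by (cases "w = 0") (auto simp: abs_powr_deriv_def intro!: powr_less_mono2)
    qed
  qed
  show ?thesis using less[of v w] less[of w v] by (cases v w rule: linorder_cases) auto
qed

section \<open>The regular branch of the radial equation\<close>

text \<open>
  The left-hand side \<open>\<bar>U'\<bar>\<^sup>p - U' / r\<close> of the radial equation, expressed by \<open>w = U' / r\<close>, so that it
  also makes sense at \<open>r = 0\<close>.
\<close>

definition radial_operator :: "real \<Rightarrow> real \<Rightarrow> real \<Rightarrow> real" where
  "radial_operator p r w = r powr p * \<bar>w\<bar> powr p - w"

text \<open>
  By convexity, the derivative \<open>r powr p * abs_powr_deriv p z - 1\<close> in the variable \<open>z\<close> is negative at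
  every point to the left of one where it is nonpositive.
\<close>

lemma radial_operator_strict_antimono:
  assumes "1 < p" "0 \<le> r" "v < w" "r powr p * abs_powr_deriv p w \<le> 1"
  shows "radial_operator p r w < radial_operator p r v"
proof -
  have deriv: "((\<lambda>w. radial_operator p r w) has_real_derivative r powr p * abs_powr_deriv p z - 1) (at z)" for z
    unfolding radial_operator_def by (rule DERIV_diff[OF DERIV_cmult[OF abs_powr_has_derivative[OF assms(1)]] DERIV_ident])
  obtain z where z: "v < z" "z < w"
    "radial_operator p r w - radial_operator p r v = (w - v) * (r powr p * abs_powr_deriv p z - 1)"
    using MVT2[OF \<open>v < w\<close> deriv] by blast
  have "r powr p * abs_powr_deriv p z < 1"
  proof (cases "r = 0")
    case False
    then have "r powr p * abs_powr_deriv p z < r powr p * abs_powr_deriv p w"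
      using z assms by (simp add: abs_powr_deriv_less_iff)
    then show ?thesis using assms by linarith
  qed simp
  then have "(w - v) * (r powr p * abs_powr_deriv p z - 1) < 0"
    using assms by (intro mult_pos_neg) auto
  then show ?thesis using z by linarith
qed

text \<open>
  The minimum point is \<open>w = (p r) powr (- 1 / (p - 1)) / r\<close>, where the derivative in \<open>w\<close> vanishes.
\<close>

lemma critical_is_minimum_value:
  assumes "1 < p" "0 < r"
  obtains w where "0 < w" "r powr p * abs_powr_deriv p w = 1" "radial_operator p r w = critical p r"
proof
  define a where "a = p * r"
  have a: "0 < a" using assms by (simp add: a_def)
  define w where "w = a powr (- 1 / (p - 1)) / r"
  show w: "0 < w" using assms a by (simp add: w_def)
  have "w powr (p - 1) = a powr (- 1) / r powr (p - 1)"
    unfolding w_def using assms a by (simp add: powr_divide powr_powr)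
  also have "\<dots> = 1 / (p * r powr p)"
    using assms by (simp add: a_def powr_minus powr_diff field_simps)
  finally have wp: "r powr p * w powr (p - 1) = 1 / p"
    using assms by (simp add: field_simps)
  then show "r powr p * abs_powr_deriv p w = 1"
    using assms w by (simp add: abs_powr_deriv_def field_simps)
  have "w powr p = w powr (p - 1) * w"
    using w by (simp add: powr_diff)
  then have "radial_operator p r w = (r powr p * w powr (p - 1) - 1) * w"
    using w by (simp add: radial_operator_def algebra_simps)
  also have "\<dots> = - ((p - 1) * (a powr (- 1 / (p - 1)) / a))"
    unfolding wp using assms by (simp add: w_def a_def field_simps)
  also have "a powr (- 1 / (p - 1)) / a = a powr (- 1 / (p - 1) - 1)"
    using a by (simp add: powr_diff)
  also have "- 1 / (p - 1) - 1 = - (p / (p - 1))"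
    using assms by (simp add: field_simps)
  finally show "radial_operator p r w = critical p r"
    by (simp add: critical_def a_def powr_minus divide_inverse)
qed

locale admissible_source =
  fixes f f' :: "real \<Rightarrow> real" and R p :: real
  assumes R_pos: "0 < R" and p_gt_1: "1 < p"
    and f_deriv: "\<And>r. r \<in> {0..R} \<Longrightarrow> (f has_real_derivative f' r) (at r within {0..R})"
    and f'_cont: "continuous_on {0..R} f'"
    and above_critical: "\<And>r. r \<in> {0<..<R} \<Longrightarrow> critical p r < f r"
begin

lemma f_cont: "continuous_on {0..R} f"
  by (rule DERIV_continuous_on[OF f_deriv])

text \<open>
  The strict inequality passes to the limit at the end point \<open>R\<close>, in weakened form.
\<close>

lemma critical_le:
  assumes "r \<in> {0<..R}"
  shows "critical p r \<le> f r"
proof (cases "r = R")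
  case True
  have "((\<lambda>r. f r - critical p r) \<longlongrightarrow> f R - critical p R) (at R within {0..R})"
    unfolding critical_def using f_cont R_pos p_gt_1
    by (intro tendsto_intros) (auto simp: continuous_on_def)
  moreover have "at R within {0..R} = at_left R"
    using R_pos by (simp add: at_within_Icc_at_left)
  moreover have "\<forall>\<^sub>F r in at_left R. 0 \<le> f r - critical p r"
    unfolding eventually_at_left[OF R_pos] using R_pos above_critical
    by (intro exI[of _ 0]) (auto intro!: less_imp_le)
  ultimately have "0 \<le> f R - critical p R"
    by (intro tendsto_lowerbound) auto
  then show ?thesis using True by simp
next
  case False
  then show ?thesis using assms above_critical[of r] by simp
qed

text \<open>
  The second condition selects the root to the left of the minimum point.
  It is a closed condition, which makes the graph of the branch closed.
\<close>

definition on_branch :: "real \<Rightarrow> real \<Rightarrow> bool" where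
  "on_branch r w \<longleftrightarrow> radial_operator p r w = f r \<and> r powr p * abs_powr_deriv p w \<le> 1"

text \<open>
  The intermediate value theorem between \<open>- \<bar>f r\<bar>\<close>, where the operator is at least \<open>f r\<close>, and the minimum
  point, where it equals \<open>critical p r\<close>.
\<close>

lemma on_branch_exists:
  assumes "r \<in> {0..R}"
  shows "\<exists>w. on_branch r w"
proof (cases "r = 0")
  case True
  then show ?thesis by (intro exI[of _ "- f 0"]) (simp add: on_branch_def radial_operator_def)
next
  case False
  then obtain w where w: "0 < w" "r powr p * abs_powr_deriv p w = 1" "radial_operator p r w = critical p r"
    using critical_is_minimum_value[OF p_gt_1, of r] assms by (metis atLeastAtMost_iff order_le_less)
  have "f r \<le> radial_operator p r (- \<bar>f r\<bar>)"
    using mult_nonneg_nonneg[OF powr_ge_zero powr_ge_zero, of r p "\<bar>f r\<bar>" p]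
    unfolding radial_operator_def abs_minus_cancel abs_idempotent by linarith
  moreover have "radial_operator p r w \<le> f r"
    using w critical_le[of r] assms False by auto
  moreover have "continuous_on {- \<bar>f r\<bar>..w} (radial_operator p r)"
    unfolding radial_operator_def using p_gt_1 by (intro continuous_intros continuous_on_powr') auto
  ultimately obtain z where z: "z \<le> w" "radial_operator p r z = f r"
    using IVT2'[of "radial_operator p r" w "f r" "- \<bar>f r\<bar>"] w by force
  have "abs_powr_deriv p z \<le> abs_powr_deriv p w"
    using z abs_powr_deriv_less_iff[OF p_gt_1, of w z] by linarith
  then have "r powr p * abs_powr_deriv p z \<le> 1"
    unfolding w(2)[symmetric] by (rule mult_left_mono) simp
  with z show ?thesis unfolding on_branch_def by blast
qed

lemma on_branch_unique:
  assumes "r \<in> {0..R}" "on_branch r v" "on_branch r w"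
  shows "v = w"
  using radial_operator_strict_antimono[OF p_gt_1, of r v w] radial_operator_strict_antimono[OF p_gt_1, of r w v] assms
  by (cases v w rule: linorder_cases) (auto simp: on_branch_def)

definition branch :: "real \<Rightarrow> real" where
  "branch r = (THE w. on_branch r w)"

lemma branch_on_branch:
  assumes "r \<in> {0..R}"
  shows "on_branch r (branch r)"
proof -
  have "\<exists>!w. on_branch r w"
    using on_branch_exists[OF assms] on_branch_unique[OF assms] by (rule ex_ex1I)
  then show ?thesis unfolding branch_def by (rule theI')
qed

lemma branch_eqI: "r \<in> {0..R} \<Longrightarrow> on_branch r w \<Longrightarrow> branch r = w"
  using on_branch_unique branch_on_branch by blast

lemma branch_solves: "r \<in> {0..R} \<Longrightarrow> radial_operator p r (branch r) = f r"
  using branch_on_branch by (simp add: on_branch_def)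

text \<open>
  For positive \<open>w\<close> the slope condition reads \<open>p r\<^sup>p w\<^sup>p\<^sup>-\<^sup>1 \<le> 1\<close>, so that \<open>r\<^sup>p w\<^sup>p \<le> w / p\<close> and the linear
  term \<open>- w\<close> dominates in the equation. The bound is independent of \<open>r\<close>, although the minimum point
  escapes to infinity as \<open>r\<close> tends to 0; it also yields the sign of the branch for \<open>f \<ge> 0\<close>.
\<close>

lemma on_branch_upper_bound:
  assumes "on_branch r w" "0 < w"
  shows "(p - 1) / p * w \<le> - f r"
proof -
  have "r powr p * (p * w powr (p - 1)) * w \<le> 1 * w"
    using assms by (intro mult_right_mono) (auto simp: on_branch_def abs_powr_deriv_def)
  moreover have "w powr p = w powr (p - 1) * w"
    using assms by (simp add: powr_diff)
  ultimately have "p * (r powr p * w powr p) \<le> w"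
    by (simp add: mult_ac)
  then have "r powr p * w powr p \<le> w / p"
    using p_gt_1 by (simp add: field_simps)
  then have "f r \<le> w / p - w"
    using assms by (auto simp: on_branch_def radial_operator_def)
  then show ?thesis using p_gt_1 by (simp add: field_simps)
qed

lemma branch_nonneg:
  assumes "r \<in> {0..R}" "f r \<le> 0"
  shows "0 \<le> branch r"
proof (rule ccontr)
  assume "\<not> 0 \<le> branch r"
  moreover have "0 \<le> r powr p * \<bar>branch r\<bar> powr p" by simp
  ultimately show False using branch_solves[OF assms(1)] assms(2) by (simp only: radial_operator_def)
qed

lemma branch_nonpos:
  assumes "r \<in> {0..R}" "0 \<le> f r"
  shows "branch r \<le> 0"
proof (rule ccontr)
  assume "\<not> branch r \<le> 0"
  then have "(p - 1) / p * branch r \<le> - f r" "0 < (p - 1) / p * branch r"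
    using on_branch_upper_bound[OF branch_on_branch[OF assms(1)]] p_gt_1 by auto
  then show False using assms(2) by linarith
qed

text \<open>
  A bounded function with closed graph is continuous. The argument also covers the case that the
  branch meets the minimum point at \<open>R\<close>, where the implicit function theorem would fail.
\<close>

lemma branch_cont: "continuous_on {0..R} branch"
proof -
  obtain M where M: "\<And>r. r \<in> {0..R} \<Longrightarrow> \<bar>f r\<bar> \<le> M"
    using compact_imp_bounded[OF compact_continuous_image[OF f_cont compact_Icc]]
    unfolding bounded_iff real_norm_def by blast
  define B where "B = p / (p - 1) * M"
  have M0: "0 \<le> M" using M[of 0] R_pos by auto
  have "branch r \<in> {- M..B}" if r: "r \<in> {0..R}" for r
  proof -
    have "- branch r \<le> radial_operator p r (branch r)"
      by (simp add: radial_operator_def)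
    then have "- M \<le> branch r"
      using branch_solves[OF r] M[OF r] by linarith
    moreover have "branch r \<le> B"
    proof (cases "0 < branch r")
      case True
      then have "(p - 1) / p * branch r \<le> M"
        using on_branch_upper_bound[OF branch_on_branch[OF r]] M[OF r] by linarith
      then show ?thesis using p_gt_1 by (simp add: B_def field_simps)
    next
      case False
      moreover have "0 \<le> B" using M0 p_gt_1 by (simp add: B_def)
      ultimately show ?thesis by linarith
    qed
    ultimately show ?thesis by simp
  qed
  then have "branch \<in> {0..R} \<rightarrow> {- M..B}" by blast
  moreover have "closed ((\<lambda>r. (r, branch r)) ` {0..R})"
  proof -
    define D where "D = {0..R} \<times> (UNIV :: real set)"
    have "closed D" unfolding D_def by (intro closed_Times) auto
    have c: "continuous_on D (\<lambda>z. abs_powr_deriv p (snd z))"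
      using continuous_at_imp_continuous_on[of UNIV "abs_powr_deriv p"] continuous_abs_powr_deriv[OF p_gt_1]
      by (auto intro!: continuous_on_compose2[of UNIV "abs_powr_deriv p"] continuous_intros)
    have "(\<lambda>r. (r, branch r)) ` {0..R}
        = {z \<in> D. radial_operator p (fst z) (snd z) = f (fst z)} \<inter> {z \<in> D. fst z powr p * abs_powr_deriv p (snd z) \<le> 1}"
      using branch_on_branch branch_eqI by (auto simp: D_def on_branch_def image_iff)
    also have "\<dots> = {z \<in> D. radial_operator p (fst z) (snd z) - f (fst z) = 0} \<inter> {z \<in> D. fst z powr p * abs_powr_deriv p (snd z) \<le> 1}"
      by auto
    also have "closed \<dots>"
    proof (intro closed_Int)
      show "closed {z \<in> D. radial_operator p (fst z) (snd z) - f (fst z) = 0}"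
        unfolding radial_operator_def using p_gt_1
        by (intro continuous_closed_preimage_constant \<open>closed D\<close> continuous_intros continuous_on_powr'
            continuous_on_compose2[OF f_cont]) (auto simp: D_def)
      show "closed {z \<in> D. fst z powr p * abs_powr_deriv p (snd z) \<le> 1}"
        using p_gt_1
        by (intro continuous_on_closed_Collect_le \<open>closed D\<close> continuous_intros continuous_on_powr' c)
          (auto simp: D_def)
    qed
    finally show ?thesis .
  qed
  ultimately show ?thesis
    by (intro continuous_from_closed_graph[of "{- M..B}"]) auto
qed

text \<open>
  The radii at which the branch stays away from the minimum point: all of \<open>[0, R)\<close>, and \<open>R\<close> itself
  if \<open>f R\<close> is above the critical value.
\<close>

definition noncritical :: "real \<Rightarrow> bool" where
  "noncritical r \<longleftrightarrow> 0 \<le> r \<and> r \<le> R \<and> (r = R \<longrightarrow> critical p R < f R)"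

text \<open>
  Equality would force the branch to be at the minimum point, because for \<open>r > 0\<close> the slope is
  injective in \<open>w\<close>;
  but there the operator takes the value \<open>critical p r\<close>, which differs from \<open>f r\<close>.
\<close>

lemma branch_slope_less_1:
  assumes "noncritical r"
  shows "r powr p * abs_powr_deriv p (branch r) < 1"
proof (cases "r = 0")
  case False
  then have r: "0 < r" "r \<in> {0..R}" and cr: "critical p r < f r"
    using assms above_critical[of r] by (cases "r = R"; simp add: noncritical_def)+
  obtain w where w: "r powr p * abs_powr_deriv p w = 1" "radial_operator p r w = critical p r"
    using critical_is_minimum_value[OF p_gt_1 r(1)] by blast
  have "branch r \<noteq> w" using w cr branch_solves[OF r(2)] by auto
  moreover have "\<not> w < branch r"
  proof
    assume "w < branch r"
    then have "r powr p * abs_powr_deriv p w < r powr p * abs_powr_deriv p (branch r)"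
      using r by (simp add: abs_powr_deriv_less_iff[OF p_gt_1])
    then show False using w branch_on_branch[OF r(2)] by (simp add: on_branch_def)
  qed
  ultimately have "r powr p * abs_powr_deriv p (branch r) < r powr p * abs_powr_deriv p w"
    using r by (simp add: abs_powr_deriv_less_iff[OF p_gt_1])
  then show ?thesis using w by simp
qed simp

text \<open>
  The formula obtained by differentiating the equation of the branch.
\<close>

definition branch_deriv :: "real \<Rightarrow> real" where
  "branch_deriv r = (p * r powr (p - 1) * \<bar>branch r\<bar> powr p - f' r) / (1 - r powr p * abs_powr_deriv p (branch r))"

text \<open>
  Since continuity of the branch is already known, implicit differentiation reduces to algebra with
  Caratheodory slopes: subtracting the equations at \<open>s\<close> and \<open>r\<close> gives
  \<open>q s * (branch s - branch r) = k s * (s - r)\<close> with \<open>q\<close> and \<open>k\<close> continuous at \<open>r\<close> and \<open>q r > 0\<close>, so the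
  difference quotient tends to \<open>k r / q r\<close>.
\<close>

lemma branch_has_derivative:
  assumes r: "0 < r" "r < R"
  shows "(branch has_real_derivative branch_deriv r) (at r)"
proof -
  have rR: "r \<in> {0..R}" and nc: "noncritical r" using r by (auto simp: noncritical_def)
  have at: "at r within {0..R} = at r" using r by (simp add: at_within_Icc_at)
  define h where "h w = \<bar>w\<bar> powr p" for w :: real
  have "(h has_real_derivative abs_powr_deriv p (branch r)) (at (branch r))"
    unfolding h_def by (rule abs_powr_has_derivative[OF p_gt_1])
  then obtain g where g: "\<And>z. h z - h (branch r) = g z * (z - branch r)" "isCont g (branch r)"
      "g (branch r) = abs_powr_deriv p (branch r)"
    unfolding CARAT_DERIV by blast
  have "((\<lambda>s. s powr p * h (branch r) - f s) has_real_derivative p * r powr (p - 1) * h (branch r) - f' r) (at r)"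
    using f_deriv[OF rR] r unfolding at by (auto intro!: derivative_eq_intros)
  then obtain k where k: "\<And>s. (s powr p * h (branch r) - f s) - (r powr p * h (branch r) - f r) = k s * (s - r)"
      "isCont k r" "k r = p * r powr (p - 1) * h (branch r) - f' r"
    unfolding CARAT_DERIV by blast
  \<comment> \<open>minus the difference quotient of the operator at \<open>s\<close> between \<open>branch r\<close> and \<open>branch s\<close>\<close>
  define q where "q s = 1 - s powr p * g (branch s)" for s
  have contW: "isCont branch r"
    using branch_cont r rR unfolding continuous_on_eq_continuous_within continuous_within isCont_def at[symmetric] by blast
  have "isCont q r"
    unfolding q_def using r contW g(2) by (intro continuous_intros isCont_o2[OF contW]) auto
  have q_r: "q r = 1 - r powr p * abs_powr_deriv p (branch r)" by (simp add: q_def g)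
  then have "0 < q r" using branch_slope_less_1[OF nc] by simp
  have id: "q s * (branch s - branch r) = k s * (s - r)" if "s \<in> {0..R}" for s
  proof -
    have "s powr p * h (branch s) - branch s = f s" "r powr p * h (branch r) - branch r = f r"
      using branch_solves[OF that] branch_solves[OF rR] by (simp_all add: radial_operator_def h_def)
    then have "k s * (s - r) = (branch s - branch r) - s powr p * (h (branch s) - h (branch r))"
      unfolding k(1)[symmetric] by (simp add: right_diff_distrib)
    then show ?thesis by (simp add: g(1) q_def left_diff_distrib)
  qed
  have ev: "\<forall>\<^sub>F s in at r. k s / q s = (branch s - branch r) / (s - r)"
  proof -
    have "\<forall>\<^sub>F s in at r. 0 < q s"
      using \<open>isCont q r\<close> \<open>0 < q r\<close> unfolding isCont_def by (rule order_tendstoD)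
    moreover have "\<forall>\<^sub>F s in at r. s \<in> {0<..<R}"
      using r by (intro eventually_at_in_open') auto
    moreover have "\<forall>\<^sub>F s in at r. s \<noteq> r"
      by (simp add: eventually_at_filter)
    ultimately show ?thesis
    proof eventually_elim
      case (elim s)
      then show ?case using id[of s] by (auto simp: field_simps)
    qed
  qed
  have "((\<lambda>s. k s / q s) \<longlongrightarrow> k r / q r) (at r)"
    using \<open>isCont q r\<close> \<open>isCont k r\<close> \<open>0 < q r\<close> unfolding isCont_def by (intro tendsto_divide) auto
  then have "((\<lambda>s. (branch s - branch r) / (s - r)) \<longlongrightarrow> k r / q r) (at r)"
    using ev by (rule Lim_transform_eventually)
  moreover have "k r / q r = branch_deriv r"
    by (simp add: k(3) q_r branch_deriv_def h_def)
  ultimately show ?thesis by (simp add: has_field_derivative_iff)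
qed

lemma branch_deriv_cont: "continuous_on (Collect noncritical) branch_deriv"
proof -
  have sub: "Collect noncritical \<subseteq> {0..R}" by (auto simp: noncritical_def)
  have branch: "continuous_on (Collect noncritical) branch" and f': "continuous_on (Collect noncritical) f'"
    using continuous_on_subset[OF branch_cont sub] continuous_on_subset[OF f'_cont sub] by auto
  have "continuous_on (Collect noncritical) (\<lambda>r. abs_powr_deriv p (branch r))"
    using continuous_at_imp_continuous_on[of UNIV "abs_powr_deriv p"] continuous_abs_powr_deriv[OF p_gt_1]
    by (auto intro!: continuous_on_compose2[OF _ branch, of UNIV])
  moreover have "1 - r powr p * abs_powr_deriv p (branch r) \<noteq> 0" if "noncritical r" for r
    using branch_slope_less_1[OF that] by simp
  ultimately show ?thesis
    unfolding branch_deriv_def using p_gt_1 branch f'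
    by (intro continuous_intros continuous_on_powr') (auto simp: noncritical_def)
qed

lemma branch_deriv_nonneg:
  assumes "noncritical r" "f' r \<le> 0"
  shows "0 \<le> branch_deriv r"
proof -
  have "0 \<le> p * r powr (p - 1) * \<bar>branch r\<bar> powr p" using p_gt_1 by simp
  then show ?thesis
    unfolding branch_deriv_def using branch_slope_less_1[OF assms(1)] assms(2) by (intro divide_nonneg_pos) linarith+
qed

end

section \<open>Radial solutions\<close>

theorem proposition3p4:
  fixes f f' :: "real \<Rightarrow> real" and R p :: real and i :: nat
  assumes "2 \<le> CARD('n::finite)" and "0 < R" and "1 < p"
    and "\<forall>r\<in>{0..R}. (f has_real_derivative f' r) (at r within {0..R})"
    and "continuous_on {0..R} f'"
    and "\<forall>r\<in>{0<..<R}. critical p r < f r"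
  shows
    "(1 < i \<and> i < CARD('n) \<longrightarrow>
        (\<exists>u :: real ^ 'n \<Rightarrow> real.
           C2_on (ball 0 R) u \<and> C1_closure (ball 0 R) u \<and>
           (critical p R < f R \<longrightarrow> C2_closure (ball 0 R) u) \<and>
           solves i p f R u \<and> radial_on (cball 0 R) u)) \<and>
     ((\<forall>r\<in>{0..R}. f r \<le> 0 \<and> f' r \<le> 0) \<longrightarrow>
        (\<exists>u :: real ^ 'n \<Rightarrow> real.
           C2_on (ball 0 R) u \<and> C1_closure (ball 0 R) u \<and>
           (critical p R < f R \<longrightarrow> C2_closure (ball 0 R) u) \<and>
           solves 1 p f R u \<and> radially_nondecreasing_on (cball 0 R) u)) \<and>
     ((\<exists>c\<ge>0. \<forall>r\<in>{0..R}. f r = c) \<longrightarrow>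
        (\<exists>u :: real ^ 'n \<Rightarrow> real. C2_closure (ball 0 R) u \<and> solves 1 p f R u \<and>
           radially_nonincreasing_on (cball 0 R) u))"
proof -
  interpret S: admissible_source f f' R p
    using assms by unfold_locales auto
  interpret P: radial_gradient R S.branch S.branch_deriv
  proof
    show "continuous_on {0..<R} S.branch_deriv"
      by (rule continuous_on_subset[OF S.branch_deriv_cont]) (auto simp: S.noncritical_def)
  qed (use assms S.branch_cont S.branch_has_derivative in auto)
  define u :: "real ^ 'n \<Rightarrow> real" where "u = P.potential"
  have C2: "C2_on (ball 0 R) u" and C1: "C1_closure (ball 0 R) u"
    unfolding u_def by (rule P.C2_on_potential P.C1_closure_potential)+
  have C2R: "C2_closure (ball 0 R) u" if "critical p R < f R"
    unfolding u_def using that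
    by (intro P.C2_closure_potential continuous_on_subset[OF S.branch_deriv_cont])
      (auto simp: S.noncritical_def)
  have solves: "solves j p f R u"
    if "1 \<le> j" "j < CARD('n)" "1 < j \<or> (\<forall>r\<in>{0<..<R}. f' r \<le> 0)" for j
    unfolding u_def
  proof (rule P.solves_potential)
    show "- S.branch r + \<bar>r * S.branch r\<bar> powr p = f r" if "r \<in> {0..<R}" for r
      using S.branch_solves[of r] that by (simp add: radial_operator_def abs_mult powr_mult)
    show "1 < j \<or> (\<forall>r\<in>{0<..<R}. 0 \<le> S.branch_deriv r)"
      using that(3) S.branch_deriv_nonneg by (auto simp: S.noncritical_def)
  qed (use that in auto)
  have "\<exists>u :: real ^ 'n \<Rightarrow> real. C2_on (ball 0 R) u \<and> C1_closure (ball 0 R) u \<and>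
      (critical p R < f R \<longrightarrow> C2_closure (ball 0 R) u) \<and> solves i p f R u \<and> radial_on (cball 0 R) u"
    if "1 < i" "i < CARD('n)"
  proof (intro exI conjI)
    show "solves i p f R u" using that by (intro solves) auto
    show "radial_on (cball 0 R) u" unfolding u_def by (rule P.radial_on_potential)
  qed (use C2 C1 C2R in auto)
  moreover have "\<exists>u :: real ^ 'n \<Rightarrow> real. C2_on (ball 0 R) u \<and> C1_closure (ball 0 R) u \<and>
      (critical p R < f R \<longrightarrow> C2_closure (ball 0 R) u) \<and> solves 1 p f R u \<and>
      radially_nondecreasing_on (cball 0 R) u"
    if "\<forall>r\<in>{0..R}. f r \<le> 0 \<and> f' r \<le> 0"
  proof (intro exI conjI)
    show "solves 1 p f R u" using assms(1) that by (intro solves) auto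
    show "radially_nondecreasing_on (cball 0 R) u"
      unfolding u_def using that by (intro P.radially_nondecreasing_potential S.branch_nonneg) auto
  qed (use C2 C1 C2R in auto)
  moreover have "\<exists>u :: real ^ 'n \<Rightarrow> real. C2_closure (ball 0 R) u \<and> solves 1 p f R u \<and>
      radially_nonincreasing_on (cball 0 R) u"
    if const: "\<exists>c\<ge>0. \<forall>r\<in>{0..R}. f r = c"
  proof -
    obtain c where c: "0 \<le> c" "\<And>r. r \<in> {0..R} \<Longrightarrow> f r = c"
      using const by blast
    have f'0: "f' r = 0" if r: "r \<in> {0<..<R}" for r
    proof -
      have "(f has_real_derivative f' r) (at r)"
        using S.f_deriv[of r] r by (simp add: at_within_Icc_at)
      moreover have "(f has_real_derivative 0) (at r)"
        by (rule has_field_derivative_transform_within_open[of "\<lambda>_. c" _ _ "{0<..<R}"]) (use r c in auto)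
      ultimately show ?thesis by (rule DERIV_unique)
    qed
    \<comment> \<open>the critical value is negative, so a nonnegative source is above it at \<open>R\<close> as well\<close>
    have "0 < (p - 1) / (p * R) powr (p / (p - 1))"
      using assms(2,3) by simp
    then have "critical p R < f R"
      using c assms(2) by (simp add: critical_def)
    then have "C2_closure (ball 0 R) u" by (rule C2R)
    moreover have "solves 1 p f R u" using assms(1) f'0 by (intro solves) auto
    moreover have "radially_nonincreasing_on (cball 0 R) u"
      unfolding u_def using c by (intro P.radially_nonincreasing_potential S.branch_nonpos) auto
    ultimately show ?thesis by blast
  qed
  ultimately show ?thesis by blast
qed

end
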